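(* For a positive integer $N$, let $$S(N)=\sum_{\substack{a,b\ge 1\\ ab\le N}}\tau(\gcd(a,b)),$$ the sum being over all ordered pairs $(a,b)$ of positive integers with $ab\le N$. Let $$\theta=\sum_{d=1}^{\infty}\frac{\log d}{d^2}.$$ Then $$S(N)=\zeta(2)\,N\log N+\bigl((2\gamma-1)\zeta(2)-2\theta\bigr)N+O\bigl(\sqrt{N}\bigr),$$ i.e. there is an absolute constant $C>0$ such that for all positive integers $N$, $$\Bigl|S(N)-\zeta(2)N\log N-\bigl((2\gamma-1)\zeta(2)-2\theta\bigr)N\Bigr|\le C\sqrt{N}.$$
   Context: $\tau(n)$ denotes the number of positive divisors of the positive integer $n$. $\zeta(2)=\sum_{j\ge1}1/j^2$, $\gamma$ is the Euler–Mascheroni constant, and $\log$ is the natural logarithm. *)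

theory Defs
  imports "HOL-Analysis.Analysis"
begin

definition tau :: "nat \<Rightarrow> nat" where
  "tau n = card {d. d dvd n}"

definition S :: "nat \<Rightarrow> nat" where
  "S N = (\<Sum>(a, b) \<in> {(a, b). 1 \<le> a \<and> 1 \<le> b \<and> a * b \<le> N}. tau (gcd a b))"

definition zeta2 :: real where
  "zeta2 = (\<Sum>j. 1 / real (Suc j) ^ 2)"

definition theta :: real where
  "theta = (\<Sum>d. ln (real (Suc d)) / real (Suc d) ^ 2)"

end

theory Submission
  imports Defs
begin

text \<open>
  Sorting by the common divisors \<open>d\<close> of \<open>a\<close> and \<open>b\<close> gives \<open>S(N) = \<Sum>\<^sub>d D(N/d\<^sup>2)\<close>, where \<open>D(x)\<close>
  counts the pairs with \<open>ab \<le> x\<close>. Dirichlet's error term \<open>O(\<surd>x)\<close> for \<open>D(x)\<close> would only yield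
  \<open>O(\<surd>N log N)\<close>, so a power saving is needed; any exponent below \<open>1/2\<close> suffices, since then
  \<open>\<Sum>\<^sub>d (N/d\<^sup>2)\<^sup>e\<close> over \<open>d \<le> \<surd>N\<close> is \<open>O(\<surd>N)\<close>. Here \<open>e = 17/36\<close>.

  The hyperbola method reduces \<open>D(x)\<close> to the sum of \<open>\<psi>(x/n)\<close> over \<open>n \<le> \<surd>x\<close>, with \<open>\<psi>\<close> the sawtooth
  function. Near \<open>n\<close> the map \<open>h \<mapsto> x/(n+h)\<close> is almost linear with slope \<open>-x/n\<^sup>2\<close>. If Dirichlet
  approximates \<open>x/n\<^sup>2\<close> by \<open>a/q\<close>, then over a block of \<open>q\<close> consecutive arguments the values are nearly
  equidistributed modulo 1, and the block contributes \<open>O(1)\<close> instead of \<open>O(q)\<close>. The \<open>n\<close> for which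
  only a small denominator \<open>q\<close> is available are few, because \<open>x/n\<^sup>2\<close> varies with \<open>n\<close> and so rarely
  comes close to a fraction with small denominator.
\<close>

section \<open>Sawtooth sums along a hyperbola\<close>

text \<open>The value at integers is -1/2 rather than the customary 0, so that the floor of
  \<open>t\<close> equals \<open>t - sawtooth t - 1 / 2\<close> without exception.\<close>

definition sawtooth :: "real \<Rightarrow> real" where
  "sawtooth t = frac t - 1 / 2"

lemma abs_sawtooth_le: "\<bar>sawtooth t\<bar> \<le> 1"
  using frac_lt_1[of t] frac_ge_0[of t] unfolding sawtooth_def by linarith

section \<open>Equidistribution modulo 1 over one block\<close>

lemma bij_betw_affine_mod:
  fixes a k :: int and q :: nat
  assumes "coprime a (int q)" "q > 0"
  shows "bij_betw (\<lambda>h. nat ((a * int h + k) mod int q)) {..<q} {..<q}"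
proof -
  have inj: "inj_on (\<lambda>h. nat ((a * int h + k) mod int q)) {..<q}"
  proof (rule inj_onI)
    fix h j assume h: "h \<in> {..<q}" and j: "j \<in> {..<q}"
      and eq: "nat ((a * int h + k) mod int q) = nat ((a * int j + k) mod int q)"
    have "(a * int h + k) mod int q = (a * int j + k) mod int q"
      using eq assms(2) by (simp add: eq_nat_nat_iff)
    then have "int q dvd a * (int h - int j)"
      by (simp add: mod_eq_dvd_iff algebra_simps)
    then have "int q dvd int h - int j"
      using assms(1) by (simp add: coprime_dvd_mult_right_iff coprime_commute)
    then have "int h mod int q = int j mod int q"
      by (simp add: mod_eq_dvd_iff)
    then show "h = j"
      using h j by simp
  qed
  moreover have "(\<lambda>h. nat ((a * int h + k) mod int q)) ` {..<q} \<subseteq> {..<q}"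
    using assms(2) by (auto simp: nat_less_iff)
  ultimately show ?thesis
    by (simp add: bij_betw_def endo_inj_surj)
qed

text \<open>With \<open>q * b = k + r\<close> and \<open>0 \<le> r < 1\<close>, the summands are
  \<open>(r + p) / q\<close>, where \<open>p\<close> runs once through the residues modulo
  \<open>q\<close>. Hence \<open>b\<close> influences the sum only through one fractional part,
  which is why a block of any length costs \<open>O(1)\<close>.\<close>

lemma sum_frac_equidistributed:
  fixes a :: int and q :: nat and b :: real
  assumes "coprime a (int q)" "q > 0"
  shows "(\<Sum>h<q. frac (b + of_int a * real h / real q)) = frac (real q * b) + (real q - 1) / 2"
proof -
  define k where "k = \<lfloor>real q * b\<rfloor>"
  define r where "r = frac (real q * b)"
  have b: "b = (r + of_int k) / real q"
    using assms(2) by (simp add: r_def k_def frac_def)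
  have r: "0 \<le> r" "r < 1"
    by (simp_all add: r_def frac_lt_1)
  define p where "p h = nat ((a * int h + k) mod int q)" for h
  have frac_eq: "frac (b + of_int a * real h / real q) = (r + real (p h)) / real q" for h
  proof -
    define z where "z = a * int h + k"
    have "z = int q * (z div int q) + z mod int q"
      by simp
    moreover have pz: "int (p h) = z mod int q"
      using assms(2) by (simp add: p_def z_def)
    ultimately have "z = int q * (z div int q) + int (p h)"
      by simp
    then have "real_of_int z = real q * of_int (z div int q) + real (p h)"
      by (metis of_int_add of_int_mult of_int_of_nat_eq)
    moreover have "b + of_int a * real h / real q = (r + of_int z) / real q"
      by (simp add: b z_def add_divide_distrib)
    ultimately have "b + of_int a * real h / real q = (r + real (p h)) / real q + of_int (z div int q)"
      using assms(2) by (simp add: add_divide_distrib)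
    moreover have "int (p h) < int q"
      using assms(2) by (simp add: pz)
    then have "real (p h) + 1 \<le> real q"
      by linarith
    then have "(r + real (p h)) / real q < 1" "0 \<le> (r + real (p h)) / real q"
      using assms(2) r by (simp_all add: field_simps)
    ultimately show ?thesis
      by (simp add: frac_unique_iff)
  qed
  have "(\<Sum>h<q. real (p h)) = (\<Sum>h<q. real h)"
    using sum.reindex_bij_betw[OF bij_betw_affine_mod[OF assms, of k], of real]
    by (simp add: p_def)
  also have "\<dots> = real q * (real q - 1) / 2"
    by (induction q) (simp_all add: field_simps)
  finally have "(\<Sum>h<q. real (p h)) = real q * (real q - 1) / 2" .
  then have "(\<Sum>h<q. (r + real (p h)) / real q) = r + (real q - 1) / 2"
    using assms(2) by (simp add: sum_divide_distrib[symmetric] sum.distrib field_simps)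
  then show ?thesis
    by (simp add: frac_eq r_def)
qed

text \<open>\<open>frac\<close> jumps at integers, so it is not compared with its value at
  \<open>t\<close>. The points \<open>t - eps\<close> and \<open>t + eps\<close> do not depend on
  \<open>e\<close>, and monotonicity of the floor turns any jump in between in the right direction.
  In a sum the shift is then absorbed into \<open>b\<close>.\<close>

lemma frac_perturb:
  fixes t e eps :: real
  assumes "\<bar>e\<bar> \<le> eps"
  shows "frac (t + e) \<le> frac (t - eps) + 2 * eps" "frac (t + eps) - 2 * eps \<le> frac (t + e)"
proof -
  have "\<lfloor>t - eps\<rfloor> \<le> \<lfloor>t + e\<rfloor>" "\<lfloor>t + e\<rfloor> \<le> \<lfloor>t + eps\<rfloor>"
    using assms by (auto intro!: floor_mono)
  then show "frac (t + e) \<le> frac (t - eps) + 2 * eps" "frac (t + eps) - 2 * eps \<le> frac (t + e)"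
    using assms by (simp_all add: frac_def)
qed

text \<open>The sum is squeezed between two exactly linear ones, with \<open>b\<close> replaced by
  \<open>b - eps\<close> and \<open>b + eps\<close>; their fractional parts sum to within 1/2 of
  \<open>q / 2\<close>.\<close>

lemma sum_sawtooth_near_linear:
  fixes a :: int and q :: nat and b eps :: real
  assumes "coprime a (int q)" "q > 0"
    and e: "\<And>h. h < q \<Longrightarrow> \<bar>e h\<bar> \<le> eps"
  shows "\<bar>\<Sum>h<q. sawtooth (b + of_int a * real h / real q + e h)\<bar> \<le> 1 / 2 + 2 * real q * eps"
proof -
  let ?F = "\<lambda>b. \<Sum>h<q. frac (b + of_int a * real h / real q)"
  let ?G = "\<Sum>h<q. frac (b + of_int a * real h / real q + e h)"
  have "?G \<le> (\<Sum>h<q. frac ((b - eps) + of_int a * real h / real q) + 2 * eps)"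
  proof (rule sum_mono)
    fix h assume "h \<in> {..<q}"
    then show "frac (b + of_int a * real h / real q + e h)
        \<le> frac ((b - eps) + of_int a * real h / real q) + 2 * eps"
      using frac_perturb(1)[OF e, of h "b + of_int a * real h / real q"] by (simp add: diff_add_eq)
  qed
  then have "?G \<le> ?F (b - eps) + 2 * real q * eps"
    by (simp add: sum.distrib algebra_simps)
  moreover have "(\<Sum>h<q. frac ((b + eps) + of_int a * real h / real q) - 2 * eps) \<le> ?G"
  proof (rule sum_mono)
    fix h assume "h \<in> {..<q}"
    then show "frac ((b + eps) + of_int a * real h / real q) - 2 * eps
        \<le> frac (b + of_int a * real h / real q + e h)"
      using frac_perturb(2)[OF e, of h "b + of_int a * real h / real q"] by (simp add: add_ac)
  qed
  then have "?F (b + eps) - 2 * real q * eps \<le> ?G"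
    by (simp add: sum_subtractf algebra_simps)
  moreover have "?F (b - eps) \<le> (real q + 1) / 2"
    using frac_lt_1[of "real q * (b - eps)"] sum_frac_equidistributed[OF assms(1,2), of "b - eps"]
    by argo
  moreover have "(real q - 1) / 2 \<le> ?F (b + eps)"
    using frac_ge_0[of "real q * (b + eps)"] sum_frac_equidistributed[OF assms(1,2), of "b + eps"]
    by argo
  moreover have "(\<Sum>h<q. sawtooth (b + of_int a * real h / real q + e h)) = ?G - real q / 2"
    by (simp add: sawtooth_def sum_subtractf)
  ultimately show ?thesis
    unfolding abs_le_iff by argo
qed

text \<open>Expand \<open>x / (n + h)\<close> at \<open>n\<close>. Replacing the slope by
  \<open>-a / q\<close> costs at most \<open>1 / Q\<close>, the quadratic remainder at most
  \<open>x * Q ^ 2 / n ^ 3\<close>. By \<open>large\<close> these make \<open>q * eps\<close> at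
  most 2, and 1/2 + 2 * 2 is below 5.\<close>

lemma sum_sawtooth_block:
  fixes x :: real and n q Q :: nat and a :: int
  assumes "coprime a (int q)" "q > 0" "q \<le> Q" "n > 0" "x > 0"
    and approx: "\<bar>real q * (x / real n ^ 2) - of_int a\<bar> \<le> 1 / real Q"
    and large: "x * real Q ^ 3 \<le> real n ^ 3"
  shows "\<bar>\<Sum>i=n..<n+q. sawtooth (x / real i)\<bar> \<le> 5"
proof -
  define eps where "eps = 1 / real Q + x * real Q ^ 2 / real n ^ 3"
  define e where "e h = x / real (n + h) - (x / real n + of_int (- a) * real h / real q)" for h
  have e: "\<bar>e h\<bar> \<le> eps" if "h < q" for h
  proof -
    have "e h = (of_int a - real q * (x / real n ^ 2)) * (real h / real q)
        + x * real h ^ 2 / (real n ^ 2 * real (n + h))"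
      using \<open>n > 0\<close> \<open>q > 0\<close> unfolding e_def
      by (simp add: divide_simps power2_eq_square) (simp add: algebra_simps)
    also have "\<bar>\<dots>\<bar> \<le> \<bar>of_int a - real q * (x / real n ^ 2)\<bar> * (real h / real q)
        + x * real h ^ 2 / (real n ^ 2 * real (n + h))"
      using \<open>x > 0\<close> by (intro order.trans[OF abs_triangle_ineq]) (simp add: abs_mult)
    also have "\<dots> \<le> 1 / real Q * 1 + x * real Q ^ 2 / (real n ^ 2 * real n)"
      using approx that assms
      by (intro add_mono mult_mono frac_le mult_left_mono power_mono)
         (auto simp: abs_minus_commute)
    also have "\<dots> = eps"
      by (simp add: eps_def power3_eq_cube power2_eq_square)
    finally show ?thesis .
  qed
  have "real q * eps \<le> real Q * eps"
    using assms by (intro mult_right_mono) (auto simp: eps_def)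
  also have "\<dots> = 1 + x * real Q ^ 3 / real n ^ 3"
    using assms by (simp add: eps_def field_simps power3_eq_cube power2_eq_square)
  also have "\<dots> \<le> 2"
    using large \<open>n > 0\<close> by simp
  finally have qe: "real q * eps \<le> 2" .
  have "(\<Sum>i=n..<n+q. sawtooth (x / real i)) = (\<Sum>h<q. sawtooth (x / real (n + h)))"
    by (simp add: sum.atLeastLessThan_shift_0[of _ n] atLeast0LessThan)
  also have "\<dots> = (\<Sum>h<q. sawtooth (x / real n + of_int (- a) * real h / real q + e h))"
    by (simp add: e_def)
  also have "\<bar>\<dots>\<bar> \<le> 1 / 2 + 2 * real q * eps"
    using assms e by (intro sum_sawtooth_near_linear) auto
  finally show ?thesis
    using qe by simp
qed

text \<open>
  Greedy decomposition: from a position outside \<open>B\<close> jump over a whole block of length at least \<open>K\<close>,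
  from a position in \<open>B\<close> move on by one. The term \<open>Q\<close> pays for the last block, which may overshoot.
\<close>
lemma abs_sum_le_by_blocks:
  fixes g :: "nat \<Rightarrow> real" and n m Q :: nat and K c :: real
  assumes "K > 0" "c \<ge> 0" and g: "\<And>i. \<bar>g i\<bar> \<le> 1"
    and block: "\<And>i. n \<le> i \<Longrightarrow> i < m \<Longrightarrow> i \<notin> B \<Longrightarrow>
      \<exists>q. K \<le> real q \<and> q \<le> Q \<and> \<bar>\<Sum>j=i..<i+q. g j\<bar> \<le> c"
  shows "\<bar>\<Sum>i=n..<m. g i\<bar> \<le> real (card (B \<inter> {n..<m})) + c * real (m - n) / K + real Q"
  using block
proof (induction "m - n" arbitrary: n rule: less_induct)
  case less
  show ?case
  proof (cases "n < m")
    case False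
    then show ?thesis by simp
  next
    case True
    show ?thesis
    proof (cases "n \<in> B")
      case True
      have split: "{n..<m} = insert n {Suc n..<m}"
        using \<open>n < m\<close> by auto
      have "B \<inter> {n..<m} = insert n (B \<inter> {Suc n..<m})"
        using True \<open>n < m\<close> by auto
      then have card: "card (B \<inter> {n..<m}) = Suc (card (B \<inter> {Suc n..<m}))"
        by simp
      have IH: "\<bar>\<Sum>i=Suc n..<m. g i\<bar>
          \<le> real (card (B \<inter> {Suc n..<m})) + c * real (m - Suc n) / K + real Q"
        using \<open>n < m\<close> by (intro less.hyps less.prems) auto
      have "c * real (m - Suc n) / K \<le> c * real (m - n) / K"
        using \<open>K > 0\<close> \<open>c \<ge> 0\<close> by (intro divide_right_mono mult_left_mono) auto
      moreover have "\<bar>\<Sum>i=n..<m. g i\<bar> \<le> 1 + \<bar>\<Sum>i=Suc n..<m. g i\<bar>"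
        using g[of n] by (simp add: split)
      ultimately show ?thesis
        using IH card by simp
    next
      case False
      then obtain q where q: "K \<le> real q" "q \<le> Q" "\<bar>\<Sum>j=n..<n+q. g j\<bar> \<le> c"
        using less.prems[of n] \<open>n < m\<close> by auto
      show ?thesis
      proof (cases "n + q \<le> m")
        case True
        have "q > 0"
          using q(1) \<open>K > 0\<close> by (cases q) auto
        then have IH: "\<bar>\<Sum>i=n+q..<m. g i\<bar>
            \<le> real (card (B \<inter> {n+q..<m})) + c * real (m - (n + q)) / K + real Q"
          using \<open>n < m\<close> by (intro less.hyps less.prems) auto
        have "(\<Sum>i=n..<m. g i) = (\<Sum>i=n..<n+q. g i) + (\<Sum>i=n+q..<m. g i)"
          using True by (simp add: sum.atLeastLessThan_concat)
        then have "\<bar>\<Sum>i=n..<m. g i\<bar> \<le> c + \<bar>\<Sum>i=n+q..<m. g i\<bar>"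
          using q(3) by linarith
        moreover have "card (B \<inter> {n+q..<m}) \<le> card (B \<inter> {n..<m})"
          by (intro card_mono) auto
        moreover have "c \<le> c * real q / K"
          using q(1) \<open>K > 0\<close> \<open>c \<ge> 0\<close> by (simp add: pos_le_divide_eq mult_left_mono)
        moreover have "c * real (m - n) / K = c * real q / K + c * real (m - (n + q)) / K"
          using True by (simp add: of_nat_diff add_divide_distrib[symmetric] algebra_simps)
        ultimately show ?thesis
          using IH by simp
      next
        case False
        have "\<bar>\<Sum>i=n..<m. g i\<bar> \<le> (\<Sum>i=n..<m. \<bar>g i\<bar>)"
          by (rule sum_abs)
        also have "\<dots> \<le> (\<Sum>i=n..<m. 1)"
          by (intro sum_mono g)
        also have "\<dots> \<le> real Q"
          using False q(2) by simp
        moreover have "0 \<le> c * real (m - n) / K"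
          using \<open>K > 0\<close> \<open>c \<ge> 0\<close> by simp
        ultimately show ?thesis
          by (smt (verit) of_nat_0_le_iff)
      qed
    qed
  qed
qed


section \<open>Arguments whose slope is close to a fraction of small denominator\<close>

lemma card_le_of_diff_le:
  fixes A :: "nat set" and L :: real
  assumes "finite A" "L \<ge> 0"
    and diff: "\<And>i j. i \<in> A \<Longrightarrow> j \<in> A \<Longrightarrow> i < j \<Longrightarrow> real j - real i \<le> L"
  shows "real (card A) \<le> L + 1"
proof (cases "A = {}")
  case True
  then show ?thesis using assms by simp
next
  case False
  have "A \<subseteq> {Min A..Max A}"
    using \<open>finite A\<close> by auto
  then have "card A \<le> card {Min A..Max A}"
    by (intro card_mono) auto
  moreover have le: "Min A \<le> Max A"
    using \<open>finite A\<close> False by simp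
  moreover have "real (Max A) - real (Min A) \<le> L"
    using le diff[of "Min A" "Max A"] \<open>finite A\<close> False \<open>L \<ge> 0\<close>
    by (cases "Min A = Max A") auto
  ultimately show ?thesis
    by (simp add: of_nat_diff)
qed

lemma finite_nat_real_le: "finite {n :: nat. real n \<le> b}"
  by (rule finite_subset[of _ "{..nat \<lfloor>b\<rfloor>}"]) (auto simp: le_nat_floor)

text \<open>Since \<open>x = s ^ 2\<close>, the map sending \<open>u\<close> to
  \<open>x / u ^ 2\<close> decreases on \<open>u \<le> s\<close> at rate at least
  \<open>1 / s\<close>. Points with values in a window of width \<open>2 * del\<close> therefore
  span at most \<open>2 * del * s\<close>.\<close>

lemma card_derivative_near:
  fixes x s del c :: real and q :: nat
  assumes "q > 0" "s > 0" "del \<ge> 0" "x = s ^ 2"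
  shows "real (card {n. 0 < n \<and> real n \<le> s \<and> \<bar>real q * (x / real n ^ 2) - c\<bar> \<le> del})
    \<le> 2 * del * s + 1" (is "real (card ?A) \<le> _")
proof (rule card_le_of_diff_le)
  show "finite ?A"
    by (rule finite_subset[OF _ finite_nat_real_le[of s]]) auto
  show "0 \<le> 2 * del * s"
    using assms by simp
next
  fix i j assume i: "i \<in> ?A" and j: "j \<in> ?A" and "i < j"
  define u v where "u = real i" and "v = real j"
  have uv: "0 < u" "u < v" "u \<le> s" "v \<le> s"
    using i j \<open>i < j\<close> by (auto simp: u_def v_def)
  have "real q * (x / u ^ 2) \<le> c + del" "c - del \<le> real q * (x / v ^ 2)"
    using i j by (auto simp: u_def v_def)
  then have "real q * (x / u ^ 2 - x / v ^ 2) \<le> 2 * del"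
    by (simp add: right_diff_distrib)
  moreover have "x / v ^ 2 \<le> x / u ^ 2"
    using uv assms by (intro divide_left_mono) (auto intro!: power_mono)
  then have "1 * (x / u ^ 2 - x / v ^ 2) \<le> real q * (x / u ^ 2 - x / v ^ 2)"
    using \<open>q > 0\<close> by (intro mult_right_mono) auto
  ultimately have "x / u ^ 2 - x / v ^ 2 \<le> 2 * del"
    by simp
  moreover have "(v - u) / s \<le> x / u ^ 2 - x / v ^ 2"
  proof -
    \<comment> \<open>The difference of the values is
      \<open>s ^ 2 * (v - u) * (v + u) / (u ^ 2 * v ^ 2)\<close>; this bound and
      \<open>v \<le> v + u\<close> handle the denominator.\<close>
    have "u ^ 2 * v \<le> s ^ 2 * s"
      using uv by (intro mult_mono power_mono) auto
    then have "(v - u) * (u ^ 2 * v) * v \<le> (v - u) * (s ^ 2 * s) * (v + u)"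
      using uv assms by (intro mult_mono) auto
    then show ?thesis
      using uv assms by (simp add: field_simps power2_eq_square)
  qed
  ultimately have "(v - u) / s \<le> 2 * del"
    by linarith
  then show "real j - real i \<le> 2 * del * s"
    using \<open>s > 0\<close> by (simp add: u_def v_def field_simps)
qed

text \<open>Union bound over the fractions \<open>a / q\<close>: there are at most \<open>K\<close>
  denominators, and for each the numerator lies between -1 and \<open>K * (x / A ^ 2) + 1\<close>
  because \<open>del \<le> 1\<close>. Each fraction is handled by
  \<open>card_derivative_near\<close>.\<close>

lemma card_derivative_near_rational:
  fixes x s del K A :: real
  assumes "s > 0" "0 \<le> del" "del \<le> 1" "x = s ^ 2" "K \<ge> 0" "A > 0"
  shows "real (card {n. A \<le> real n \<and> real n \<le> s \<and>
      (\<exists>(q::nat) (a::int). 0 < q \<and> real q \<le> K \<and> \<bar>real q * (x / real n ^ 2) - of_int a\<bar> \<le> del)})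
    \<le> K * (K * (x / A ^ 2) + 3) * (2 * del * s + 1)" (is "real (card ?B) \<le> _")
proof -
  define C where "C q a = {n. 0 < n \<and> real n \<le> s \<and> \<bar>real q * (x / real n ^ 2) - of_int a\<bar> \<le> del}"
    for q :: nat and a :: int
  let ?U = "K * (x / A ^ 2)"
  let ?I = "{-1..\<lfloor>?U\<rfloor> + 1}"
  let ?P = "{1..nat \<lfloor>K\<rfloor>} \<times> ?I"
  have U: "?U \<ge> 0"
    using assms by simp
  have "?B \<subseteq> (\<Union>(q, a)\<in>?P. C q a)"
  proof
    fix n assume "n \<in> ?B"
    then obtain q a where n: "A \<le> real n" "real n \<le> s" and q: "0 < q" "real q \<le> K"
      and a: "\<bar>real q * (x / real n ^ 2) - of_int a\<bar> \<le> del"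
      by auto
    have "n > 0"
      using n(1) \<open>A > 0\<close> by (cases n) auto
    have "real q * (x / real n ^ 2) \<le> ?U"
      using n q assms by (intro mult_mono divide_left_mono power_mono) auto
    moreover have "0 \<le> real q * (x / real n ^ 2)"
      using assms by simp
    ultimately have "-1 \<le> real_of_int a" "real_of_int a \<le> ?U + 1"
      using a \<open>del \<le> 1\<close> by linarith+
    then have "a \<in> ?I"
      by (simp add: le_floor_iff) linarith
    moreover have "q \<in> {1..nat \<lfloor>K\<rfloor>}"
      using q by (simp add: le_nat_floor)
    ultimately show "n \<in> (\<Union>(q, a)\<in>?P. C q a)"
      using n a \<open>n > 0\<close> by (intro UN_I[of "(q, a)"]) (simp_all add: C_def)
  qed
  moreover have "finite (C q a)" for q a
    by (rule finite_subset[OF _ finite_nat_real_le[of s]]) (auto simp: C_def)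
  ultimately have "card ?B \<le> card (\<Union>(q, a)\<in>?P. C q a)"
    by (intro card_mono) auto
  also have "\<dots> \<le> (\<Sum>(q, a)\<in>?P. card (C q a))"
    using card_UN_le[of ?P "\<lambda>(q, a). C q a"] by (simp add: case_prod_unfold)
  finally have "real (card ?B) \<le> (\<Sum>(q, a)\<in>?P. real (card (C q a)))"
    by (simp add: case_prod_unfold flip: of_nat_sum)
  also have "\<dots> \<le> (\<Sum>(q, a)\<in>?P. 2 * del * s + 1)"
  proof (rule sum_mono)
    fix p assume "p \<in> ?P"
    then show "(case p of (q, a) \<Rightarrow> real (card (C q a))) \<le> (case p of (q, a) \<Rightarrow> 2 * del * s + 1)"
      using assms by (cases p) (simp only: C_def prod.case, rule card_derivative_near, simp_all)
  qed
  also have "\<dots> = real (nat \<lfloor>K\<rfloor>) * real (nat (\<lfloor>?U\<rfloor> + 3)) * (2 * del * s + 1)"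
    by (simp add: case_prod_unfold card_cartesian_product add.commute)
  also have "\<dots> \<le> K * (?U + 3) * (2 * del * s + 1)"
  proof (intro mult_right_mono mult_mono)
    show "real (nat \<lfloor>K\<rfloor>) \<le> K"
      using \<open>K \<ge> 0\<close> by simp
    have "\<lfloor>?U\<rfloor> \<ge> 0"
      using U by simp
    then show "real (nat (\<lfloor>?U\<rfloor> + 3)) \<le> ?U + 3"
      by simp
  qed (use assms U in auto)
  finally show ?thesis .
qed

text \<open>
  With \<open>\<surd>x = w\<^sup>1\<^sup>8\<close>, the parameters are \<open>Q \<approx> w\<^sup>5\<close> for Dirichlet approximation and \<open>K = w\<close> for the
  smallest useful block length; the arguments below \<open>w\<^sup>1\<^sup>7\<close> are estimated trivially. This balances the
  three contributions.
\<close>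
lemma abs_sum_sawtooth_hyperbola_le:
  fixes w x :: real
  assumes "w \<ge> 1" "x = w ^ 36"
  shows "\<bar>\<Sum>i=1..nat \<lfloor>w ^ 18\<rfloor>. sawtooth (x / real i)\<bar> \<le> 27 * w ^ 17"
proof -
  define Q where "Q = nat \<lfloor>w ^ 5\<rfloor>"
  define m where "m = nat \<lfloor>w ^ 18\<rfloor>"
  define l where "l = nat \<lceil>w ^ 17\<rceil>"
  define B where "B = {n. w ^ 17 \<le> real n \<and> real n \<le> w ^ 18 \<and>
    (\<exists>(q::nat) (a::int). 0 < q \<and> real q \<le> w \<and> \<bar>real q * (x / real n ^ 2) - of_int a\<bar> \<le> 1 / real Q)}"
  let ?g = "\<lambda>i. sawtooth (x / real i)"
  have w1: "1 \<le> w ^ k" for k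
    using \<open>w \<ge> 1\<close> by simp
  have "Q > 0" and Q: "real Q \<le> w ^ 5" "w ^ 5 \<le> 2 * real Q"
  proof -
    have "1 \<le> \<lfloor>w ^ 5\<rfloor>"
      using w1[of 5] by simp
    then show "Q > 0" "real Q \<le> w ^ 5" "w ^ 5 \<le> 2 * real Q"
      unfolding Q_def by linarith+
  qed
  have m: "real m \<le> w ^ 18"
    using w1[of 18] unfolding m_def by linarith
  have l: "w ^ 17 \<le> real l" "real l \<le> w ^ 17 + 1" "0 < l"
    using w1[of 17] unfolding l_def by linarith+
  have "l \<le> Suc m"
  proof -
    have "w ^ 17 \<le> w ^ 18"
      using \<open>w \<ge> 1\<close> by (intro power_increasing) auto
    then show ?thesis
      unfolding l_def m_def using w1[of 17] by linarith
  qed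
  have block: "\<exists>q. w \<le> real q \<and> q \<le> Q \<and> \<bar>\<Sum>j=i..<i+q. ?g j\<bar> \<le> 5"
    if i: "l \<le> i" "i < Suc m" "i \<notin> B" for i
  proof -
    have i_le: "w ^ 17 \<le> real i" "real i \<le> w ^ 18" "i > 0"
      using i l m by linarith+
    obtain a k where ak: "coprime a k" "0 < k" "k \<le> int Q"
      "\<bar>of_int k * (x / real i ^ 2) - of_int a\<bar> < 1 / real Q"
      by (rule Dirichlet_approx_coprime[OF \<open>Q > 0\<close>])
    define q where "q = nat k"
    have k: "k = int q" and q: "q > 0" "q \<le> Q"
      using ak by (auto simp: q_def)
    have approx: "\<bar>real q * (x / real i ^ 2) - of_int a\<bar> \<le> 1 / real Q"
      using ak(4) k by simp
    have "\<not> real q \<le> w"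
      using i(3) i_le q(1) approx unfolding B_def by blast
    then have "w \<le> real q"
      by simp
    moreover have "x * real Q ^ 3 \<le> real i ^ 3"
    proof -
      \<comment> \<open>Here the size of \<open>Q\<close> is decided: 36 + 3 * 5 = 3 * 17, so the
        block condition just holds at the smallest argument \<open>w ^ 17\<close>.\<close>
      have "x * real Q ^ 3 \<le> w ^ 36 * (w ^ 5) ^ 3"
        using assms Q by (intro mult_mono power_mono) auto
      also have "\<dots> = (w ^ 17) ^ 3"
        by (simp flip: power_mult power_add)
      also have "\<dots> \<le> real i ^ 3"
        using assms i_le by (intro power_mono) auto
      finally show ?thesis .
    qed
    then have "\<bar>\<Sum>j=i..<i+q. ?g j\<bar> \<le> 5"
      using ak(1) k q i_le approx w1[of 36] assms by (intro sum_sawtooth_block[of a q Q i x]) auto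
    ultimately show ?thesis
      using q by blast
  qed
  have "\<bar>\<Sum>i=l..<Suc m. ?g i\<bar> \<le> real (card (B \<inter> {l..<Suc m})) + 5 * real (Suc m - l) / w + real Q"
    using assms block by (intro abs_sum_le_by_blocks) (auto simp: abs_sawtooth_le)
  moreover have "real (card (B \<inter> {l..<Suc m})) \<le> 20 * w ^ 17"
  proof -
    have "finite B"
      unfolding B_def by (rule finite_subset[OF _ finite_nat_real_le[of "w ^ 18"]]) auto
    then have "real (card (B \<inter> {l..<Suc m})) \<le> real (card B)"
      by (intro of_nat_mono card_mono) auto
    also have "\<dots> \<le> w * (w * (x / (w ^ 17) ^ 2) + 3) * (2 * (1 / real Q) * w ^ 18 + 1)"
      unfolding B_def using assms \<open>Q > 0\<close> w1
      by (intro card_derivative_near_rational) (auto simp flip: power_mult)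
    \<comment> \<open>At most \<open>w\<close> denominators, \<open>O(w ^ 3)\<close> numerators for
      each, and \<open>O(w ^ 13)\<close> arguments near each fraction.\<close>
    also have "\<dots> \<le> w * (4 * w ^ 3) * (5 * w ^ 13)"
    proof (intro mult_mono)
      have "x / (w ^ 17) ^ 2 = w ^ 2"
        using assms by (simp add: field_simps flip: power_mult power_add)
      then have "w * (x / (w ^ 17) ^ 2) = w ^ 3"
        by (simp add: power2_eq_square power3_eq_cube)
      then show "w * (x / (w ^ 17) ^ 2) + 3 \<le> 4 * w ^ 3"
        using w1[of 3] by simp
      have "w ^ 18 = w ^ 5 * w ^ 13"
        by (simp flip: power_add)
      also have "\<dots> \<le> 2 * real Q * w ^ 13"
        using Q assms by (intro mult_right_mono) auto
      finally have "2 * (1 / real Q) * w ^ 18 \<le> 4 * w ^ 13"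
        using \<open>Q > 0\<close> by (simp add: field_simps)
      then show "2 * (1 / real Q) * w ^ 18 + 1 \<le> 5 * w ^ 13"
        using w1[of 13] by linarith
    qed (use assms in auto)
    also have "\<dots> = 20 * w ^ 17"
    proof -
      have "w ^ 17 = w * (w ^ 3 * w ^ 13)"
        by (simp flip: power_add power_Suc)
      then show ?thesis
        by simp
    qed
    finally show ?thesis .
  qed
  moreover have "5 * real (Suc m - l) / w \<le> 5 * w ^ 17"
  proof -
    have "real (Suc m - l) \<le> w ^ 18"
      using m \<open>0 < l\<close> by linarith
    also have "\<dots> = w ^ 17 * w"
      by (simp flip: power_Suc2)
    finally show ?thesis
      using assms by (simp add: field_simps)
  qed
  moreover have "w ^ 5 \<le> w ^ 17"
    using assms by (intro power_increasing) auto
  moreover have "\<bar>\<Sum>i=1..<l. ?g i\<bar> \<le> w ^ 17"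
  proof -
    have "\<bar>\<Sum>i=1..<l. ?g i\<bar> \<le> (\<Sum>i=1..<l. \<bar>?g i\<bar>)"
      by (rule sum_abs)
    also have "\<dots> \<le> (\<Sum>i=1..<l. 1)"
      by (intro sum_mono abs_sawtooth_le)
    also have "\<dots> \<le> w ^ 17"
      using l by (simp add: of_nat_diff)
    finally show ?thesis .
  qed
  moreover have "(\<Sum>i=1..m. ?g i) = (\<Sum>i=1..<l. ?g i) + (\<Sum>i=l..<Suc m. ?g i)"
    using \<open>l \<le> Suc m\<close> \<open>0 < l\<close>
    by (simp add: sum.atLeastLessThan_concat atLeastLessThanSuc_atLeastAtMost[symmetric] del: sum.op_ivl_Suc)
  \<comment> \<open>27 = 1 + 20 + 5 + 1: small arguments, exceptional arguments, full blocks, and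
    the overshooting last block of length at most \<open>Q\<close>.\<close>
  ultimately show ?thesis
    using Q unfolding m_def[symmetric] by linarith
qed

section \<open>The Dirichlet divisor problem with a power saving\<close>

text \<open>The bound is real because it will be \<open>N / d ^ 2\<close>.\<close>

definition hyperbola_pairs :: "real \<Rightarrow> (nat \<times> nat) set" where
  "hyperbola_pairs x = {(a, b). 1 \<le> a \<and> 1 \<le> b \<and> real (a * b) \<le> x}"

lemma finite_hyperbola_pairs: "finite (hyperbola_pairs x)"
proof (rule finite_subset)
  show "hyperbola_pairs x \<subseteq> {n. real n \<le> x} \<times> {n. real n \<le> x}"
  proof
    fix p assume "p \<in> hyperbola_pairs x"
    then obtain a b where p: "p = (a, b)" "1 \<le> a" "1 \<le> b" "real (a * b) \<le> x"
      by (auto simp: hyperbola_pairs_def)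
    then have "a \<le> a * b" "b \<le> a * b"
      by auto
    then have "real a \<le> real (a * b)" "real b \<le> real (a * b)"
      by (simp_all only: of_nat_le_iff)
    then have "real a \<le> x" "real b \<le> x"
      using p(4) by (blast intro: order.trans)+
    then show "p \<in> {n. real n \<le> x} \<times> {n. real n \<le> x}"
      using p(1) by simp
  qed
qed (simp add: finite_nat_real_le)

text \<open>Hyperbola method: one coordinate of each pair is at most \<open>m\<close>. The pairs
  with small first coordinate and their mirror images cover everything and overlap in the square of
  side \<open>m\<close>.\<close>

lemma card_hyperbola_pairs:
  fixes x :: real
  assumes "x \<ge> 0"
  defines "m \<equiv> nat \<lfloor>sqrt x\<rfloor>"
  shows "real (card (hyperbola_pairs x)) = 2 * (\<Sum>i=1..m. of_int \<lfloor>x / real i\<rfloor>) - real m ^ 2"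
proof -
  have m: "real m \<le> sqrt x" "sqrt x < real m + 1"
    using real_sqrt_ge_zero[OF assms(1)] unfolding m_def by linarith+
  define P1 where "P1 = Sigma {1..m} (\<lambda>a. {1..nat \<lfloor>x / real a\<rfloor>})"
  define P2 where "P2 = prod.swap ` P1"
  have P1_iff: "(a, b) \<in> P1 \<longleftrightarrow> a \<le> m \<and> (a, b) \<in> hyperbola_pairs x" for a b
  proof -
    have "b \<le> nat \<lfloor>x / real a\<rfloor> \<longleftrightarrow> real (a * b) \<le> x" if "1 \<le> a" "1 \<le> b"
    proof -
      have "b \<le> nat \<lfloor>x / real a\<rfloor> \<longleftrightarrow> int b \<le> \<lfloor>x / real a\<rfloor>"
        using that(2) by linarith
      also have "\<dots> \<longleftrightarrow> real b \<le> x / real a"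
        by (simp add: le_floor_iff)
      also have "\<dots> \<longleftrightarrow> real (a * b) \<le> x"
        using that by (simp add: field_simps)
      finally show ?thesis .
    qed
    then show ?thesis
      by (auto simp: P1_def hyperbola_pairs_def)
  qed
  have P2_iff: "(a, b) \<in> P2 \<longleftrightarrow> b \<le> m \<and> (a, b) \<in> hyperbola_pairs x" for a b
  proof -
    have "(a, b) \<in> P2 \<longleftrightarrow> (b, a) \<in> P1"
      by (force simp: P2_def)
    then show ?thesis
      by (simp add: P1_iff) (auto simp: hyperbola_pairs_def mult.commute)
  qed
  have "hyperbola_pairs x = P1 \<union> P2"
  proof -
    have "a \<le> m \<or> b \<le> m" if "(a, b) \<in> hyperbola_pairs x" for a b
    proof (rule ccontr)
      assume "\<not> (a \<le> m \<or> b \<le> m)"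
      then have "sqrt x < real a" "sqrt x < real b"
        using m by linarith+
      then have "sqrt x * sqrt x < real a * real b"
        using real_sqrt_ge_zero[OF assms(1)] by (intro mult_strict_mono) linarith+
      then show False
        using that assms(1) by (simp add: hyperbola_pairs_def)
    qed
    then show ?thesis
      using P1_iff P2_iff by fast
  qed
  moreover have "P1 \<inter> P2 = {1..m} \<times> {1..m}"
  proof -
    have "real a * real b \<le> x" if "a \<le> m" "b \<le> m" for a b
    proof -
      have "real a * real b \<le> sqrt x * sqrt x"
        using that m assms(1) by (intro mult_mono) auto
      then show ?thesis
        using assms(1) by simp
    qed
    then show ?thesis
      by (auto simp: P1_iff P2_iff) (auto simp: hyperbola_pairs_def)
  qed
  moreover have fin: "finite P1" "finite P2"
    by (auto simp: P1_def P2_def)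
  moreover have "card P2 = card P1"
    unfolding P2_def by (rule card_image) (auto simp: inj_on_def)
  ultimately have "2 * card P1 = card (hyperbola_pairs x) + m ^ 2"
    using card_Un_Int[OF fin] by (simp add: card_cartesian_product power2_eq_square)
  then have "2 * real (card P1) = real (card (hyperbola_pairs x)) + real m ^ 2"
    by (metis of_nat_add of_nat_mult of_nat_numeral of_nat_power)
  moreover have "real (card P1) = (\<Sum>i=1..m. of_int \<lfloor>x / real i\<rfloor>)"
    using assms(1) by (simp add: P1_def card_SigmaI)
  ultimately show ?thesis
    by simp
qed

text \<open>\<open>harm m\<close> is multiplied by \<open>2 * x\<close>, so it must be known up to
  \<open>O(1 / x)\<close>, hence including its term of order \<open>1 / m\<close>. The contributions
  \<open>2 * s * v\<close> and \<open>s\<close> then cancel against \<open>m + m ^ 2\<close>,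
  leaving a bounded remainder.\<close>

lemma harmonic_main_term:
  fixes x :: real
  assumes "x \<ge> 1"
  defines "m \<equiv> nat \<lfloor>sqrt x\<rfloor>"
  shows "\<bar>2 * x * harm m - real m - real m ^ 2 - (x * ln x + (2 * euler_mascheroni - 1) * x)\<bar> \<le> 5"
proof -
  define s where "s = sqrt x"
  \<comment> \<open>Measured from \<open>m + 1\<close> because the bounds for Euler's constant
    involve \<open>ln (m + 1)\<close>; this makes \<open>ln (1 + v / s)\<close> a logarithm with
    \<open>v / s \<ge> 0\<close>.\<close>
  define v where "v = real m + 1 - s"
  have s: "s \<ge> 1" "x = s ^ 2"
    using assms(1) by (simp_all add: s_def)
  have "1 \<le> \<lfloor>s\<rfloor>"
    using s(1) by simp
  then have m: "real m \<le> s" "s < real m + 1" "1 \<le> real m"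
    unfolding m_def s_def[symmetric] by linarith+
  have v: "0 \<le> v" "v \<le> 1" and mv: "real m = s + v - 1"
    using m by (simp_all add: v_def)
  have sq: "2 * x * (v / s) = 2 * s * v" "2 * x * (v / s)\<^sup>2 = 2 * v ^ 2"
    using s by (simp_all add: power2_eq_square)
  have lnM: "ln (real m + 1) = ln s + ln (1 + v / s)"
  proof -
    have "real m + 1 = s * (1 + v / s)"
      using s by (simp add: mv field_simps)
    moreover have "0 < 1 + v / s"
      using s v by (simp add: add_pos_nonneg)
    ultimately show ?thesis
      using s by (simp add: ln_mult)
  qed
  have lnx: "2 * x * ln s = x * ln x"
    using s by (simp add: ln_realpow)
  have "euler_mascheroni \<in> {harm m - ln (real (Suc m)) + inverse (real (2 * (m + 1)))
      ..harm m - ln (real (Suc m)) + inverse (real (2 * m))}"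
    using m by (intro euler_mascheroni_bounds) auto
  then have harm: "harm m \<le> euler_mascheroni + ln (real m + 1) - 1 / (2 * (real m + 1))"
      "harm m \<ge> euler_mascheroni + ln (real m + 1) - 1 / (2 * real m)"
    by (simp_all add: inverse_eq_divide add.commute algebra_simps)
  have mm: "real m + real m ^ 2 = s\<^sup>2 + 2 * s * v + v\<^sup>2 - s - v"
    by (simp add: mv power2_eq_square algebra_simps)
  have v2: "0 \<le> v ^ 2" "v ^ 2 \<le> 1"
    using v by (simp_all add: power_le_one)
  have "2 * x * harm m \<le> 2 * x * (euler_mascheroni + ln (real m + 1) - 1 / (2 * (real m + 1)))"
    using harm(1) assms(1) by (intro mult_left_mono) auto
  also have "\<dots> = 2 * euler_mascheroni * x + 2 * x * ln s + 2 * x * ln (1 + v / s) - x / (real m + 1)"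
  proof -
    have "2 * x * (1 / (2 * (real m + 1))) = x / (real m + 1)"
      by (metis mult.right_neutral mult_divide_mult_cancel_left times_divide_eq_right zero_neq_numeral)
    then show ?thesis
      unfolding lnM distrib_left right_diff_distrib by simp
  qed
  finally have "2 * x * harm m
      \<le> 2 * euler_mascheroni * x + 2 * x * ln s + 2 * x * ln (1 + v / s) - x / (real m + 1)" .
  moreover have "2 * x * ln (1 + v / s) \<le> 2 * x * (v / s)"
    using assms(1) s v by (intro mult_left_mono ln_add_one_self_le_self) auto
  moreover have "s - 1 \<le> x / (real m + 1)"
  proof -
    have "(s - 1) * (real m + 1) \<le> (s - 1) * (s + 1)"
      using s m by (intro mult_left_mono) auto
    also have "\<dots> \<le> x"
      using s by (simp add: algebra_simps power2_eq_square)
    finally show ?thesis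
      using m by (simp add: field_simps)
  qed
  ultimately have upper: "2 * x * harm m \<le> 2 * euler_mascheroni * x + x * ln x + 2 * s * v - (s - 1)"
    unfolding lnx sq by linarith
  have "2 * x * (euler_mascheroni + ln (real m + 1) - 1 / (2 * real m)) \<le> 2 * x * harm m"
    using harm(2) assms(1) by (intro mult_left_mono) auto
  moreover have "2 * x * (euler_mascheroni + ln (real m + 1) - 1 / (2 * real m))
      = 2 * euler_mascheroni * x + 2 * x * ln s + 2 * x * ln (1 + v / s) - x / real m"
    unfolding lnM distrib_left right_diff_distrib by simp
  moreover have "2 * x * (v / s - (v / s)\<^sup>2) \<le> 2 * x * ln (1 + v / s)"
    using assms(1) s v by (intro mult_left_mono ln_one_plus_pos_lower_bound) auto
  moreover have "x / real m \<le> s + 2"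
  proof -
    have "s * s \<le> s * (real m + 1)"
      using s m by (intro mult_left_mono) auto
    also have "\<dots> \<le> (s + 2) * real m"
      using m by (simp add: algebra_simps)
    finally show ?thesis
      using s m by (simp add: field_simps power2_eq_square)
  qed
  ultimately have lower: "2 * x * harm m
      \<ge> 2 * euler_mascheroni * x + x * ln x + 2 * s * v - 2 * v ^ 2 - (s + 2)"
    unfolding right_diff_distrib lnx sq by linarith
  have "(2 * euler_mascheroni - 1) * x = 2 * euler_mascheroni * x - s ^ 2"
    using s(2) by (simp add: left_diff_distrib)
  then show ?thesis
    using upper lower mm v v2 by linarith
qed

text \<open>The classical Delta of the Dirichlet divisor problem. For \<open>0 < x < 1\<close> no
  pair is counted and minus the main term remains.\<close>

definition divisor_error :: "real \<Rightarrow> real" where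
  "divisor_error x = real (card (hyperbola_pairs x)) - (x * ln x + (2 * euler_mascheroni - 1) * x)"

text \<open>Writing floors through \<open>sawtooth\<close> leaves twice a sawtooth sum and a bounded
  main-term error: 59 = 2 * 27 + 5.\<close>

lemma divisor_error_ge_1:
  fixes x :: real
  assumes "x \<ge> 1"
  shows "\<bar>divisor_error x\<bar> \<le> 59 * x powr (17 / 36)"
proof -
  define w where "w = x powr (1 / 36)"
  define m where "m = nat \<lfloor>sqrt x\<rfloor>"
  have w: "w \<ge> 1"
    using assms by (simp add: w_def ge_one_powr_ge_zero)
  have w_pow: "w ^ k = x powr (real k / 36)" for k
  proof -
    have "w ^ k = w powr real k"
      using w by (subst powr_realpow) auto
    then show ?thesis
      by (simp add: w_def powr_powr)
  qed
  have x: "x = w ^ 36" and w17: "x powr (17 / 36) = w ^ 17"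
    using assms w_pow[of 36] w_pow[of 17] by simp_all
  have "sqrt x = w ^ 18"
    using assms w_pow[of 18] by (simp add: powr_half_sqrt)
  then have saw: "\<bar>\<Sum>i=1..m. sawtooth (x / real i)\<bar> \<le> 27 * w ^ 17"
    using abs_sum_sawtooth_hyperbola_le[OF w x] by (simp add: m_def)
  have "of_int \<lfloor>t\<rfloor> = t - sawtooth t - 1 / 2" for t
    by (simp add: sawtooth_def frac_def)
  then have "(\<Sum>i=1..m. of_int \<lfloor>x / real i\<rfloor>)
      = (\<Sum>i=1..m. x * inverse (real i) - sawtooth (x / real i) - 1 / 2)"
    by (simp only: divide_inverse mult_1)
  also have "\<dots> = x * harm m - (\<Sum>i=1..m. sawtooth (x / real i)) - real m / 2"
    by (simp add: sum_subtractf harm_def sum_distrib_left)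
  finally have "real (card (hyperbola_pairs x))
      = 2 * x * harm m - 2 * (\<Sum>i=1..m. sawtooth (x / real i)) - real m - real m ^ 2"
    using card_hyperbola_pairs[of x] assms by (simp add: m_def)
  moreover have "1 \<le> w ^ 17"
    using w by simp
  ultimately show ?thesis
    using saw harmonic_main_term[OF assms] unfolding divisor_error_def w17 m_def[symmetric]
    by linarith
qed

text \<open>Serves the tail \<open>d > sqrt N\<close>. The exponent is below 1 to absorb the
  logarithm and above 1/2 so that its sum over \<open>x = N / d ^ 2\<close> converges.\<close>

lemma divisor_error_less_1:
  fixes x :: real
  assumes "0 < x" "x < 1"
  shows "\<bar>divisor_error x\<bar> \<le> 5 * x powr (3 / 4)"
proof -
  have "hyperbola_pairs x = {}"
  proof -
    have False if "1 \<le> a" "1 \<le> b" "real (a * b) \<le> x" for a b :: nat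
    proof -
      have "1 \<le> a * b"
        using that by simp
      then have "1 \<le> real (a * b)"
        by (simp only: one_of_nat_le_iff)
      then show False
        using that assms by linarith
    qed
    then show ?thesis
      by (auto simp: hyperbola_pairs_def)
  qed
  then have "\<bar>divisor_error x\<bar> = \<bar>x * ln x + (2 * euler_mascheroni - 1) * x\<bar>"
    by (simp add: divisor_error_def)
  also have "\<dots> \<le> \<bar>x * ln x\<bar> + \<bar>(2 * euler_mascheroni - 1) * x\<bar>"
    by (rule abs_triangle_ineq)
  also have "\<bar>x * ln x\<bar> \<le> 4 * x powr (3 / 4)"
  proof -
    have "ln (1 / x) \<le> (1 / x) powr (1 / 4) / (1 / 4)"
      using assms by (intro ln_powr_bound) auto
    then have "- ln x \<le> 4 * x powr (- 1 / 4)"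
      using assms by (simp add: ln_div powr_divide powr_minus field_simps)
    then have "x * (- ln x) \<le> x * (4 * x powr (- 1 / 4))"
      using assms by (intro mult_left_mono) auto
    also have "\<dots> = 4 * (x powr 1 * x powr (- 1 / 4))"
      using assms by simp
    also have "\<dots> = 4 * x powr (3 / 4)"
      by (subst powr_add[symmetric]) simp
    finally show ?thesis
      using assms by (simp add: abs_mult)
  qed
  also have "\<bar>(2 * euler_mascheroni - 1) * x\<bar> \<le> 1 * x powr (3 / 4)"
  proof -
    have "\<bar>2 * euler_mascheroni - 1 :: real\<bar> \<le> 1"
      using euler_mascheroni_pos euler_mascheroni_less_13_over_22 by linarith
    moreover have "x \<le> x powr (3 / 4)"
      using assms powr_mono'[of "3/4" 1 x] by simp
    ultimately show ?thesis
      unfolding abs_mult using assms by (intro mult_mono) auto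
  qed
  finally show ?thesis
    by simp
qed

section \<open>Summation over common divisors\<close>

text \<open>Telescoping form of the integral comparison: each term is at most 18 times the increment
  of the 18th root.\<close>

lemma sum_powr_neg_17_18_le:
  "(\<Sum>d=1..m. real d powr (- 17 / 18)) \<le> 18 * real m powr (1 / 18)"
proof (induction m)
  case 0
  then show ?case by simp
next
  case (Suc m)
  define a b where "a = real (Suc m) powr (1 / 18)" and "b = real m powr (1 / 18)"
  have ab: "a > 0" "b \<ge> 0"
    by (simp_all add: a_def b_def)
  have pow: "(t powr (1 / 18)) ^ k = t powr (real k / 18)" if "t > 0" for t :: real and k
    using that by (subst powr_realpow[symmetric]) (simp_all add: powr_powr)
  have a18: "a ^ 18 = real m + 1" "b ^ 18 = real m"
    using pow[of "real (Suc m)" 18] pow[of "real m" 18] by (cases "m = 0"; simp add: a_def b_def)+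
  \<comment> \<open>Bernoulli's inequality at \<open>b / a\<close> says that the graph of the 18th
    power lies above its tangent at \<open>a\<close>.\<close>
  have "1 + real 18 * (b / a - 1) \<le> (1 + (b / a - 1)) ^ 18"
    using ab by (intro Bernoulli_inequality) simp
  then have "1 + 18 * (b / a - 1) \<le> real m / (real m + 1)"
    by (simp add: power_divide a18)
  then have "a ^ 18 * (1 + 18 * (b / a - 1)) \<le> real m"
    unfolding a18(1) by (simp add: field_simps)
  moreover have "a ^ 18 * (1 + 18 * (b / a - 1)) = a ^ 18 + 18 * a ^ 17 * (b - a)"
  proof -
    have "a ^ 18 = a ^ 17 * a"
      by (simp flip: power_Suc2)
    then show ?thesis
      using ab by (simp add: field_simps)
  qed
  ultimately have "1 \<le> 18 * (a - b) * a ^ 17"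
    using a18 by (simp add: algebra_simps)
  then have "1 / a ^ 17 \<le> 18 * (a - b)"
    using ab by (simp add: pos_divide_le_eq)
  moreover have "1 / a ^ 17 = real (Suc m) powr (- 17 / 18)"
    using pow[of "real (Suc m)" 17] by (simp add: a_def powr_minus_divide)
  ultimately have "real (Suc m) powr (- 17 / 18) \<le> 18 * a - 18 * b"
    by simp
  then show ?case
    using Suc by (simp add: a_def b_def)
qed

text \<open>Telescoping again: \<open>1 / p - 1 / r = 1 / (p * r * (r + p))\<close> is at least
  \<open>1 / (2 * r ^ 3)\<close>.\<close>

lemma sum_powr_neg_3_2_le:
  assumes "1 \<le> m" "m \<le> L"
  shows "(\<Sum>d=m+1..L. real d powr (- 3 / 2)) \<le> 2 / sqrt (real m) - 2 / sqrt (real L)"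
  using assms(2)
proof (induction L rule: dec_induct)
  case base
  then show ?case by simp
next
  case (step L)
  define p r where "p = sqrt (real L)" and "r = sqrt (real (Suc L))"
  have pr: "0 < p" "p \<le> r" "0 < r"
    using assms step by (simp_all add: p_def r_def)
  have "(r - p) * (r + p) = 1"
    using square_diff_square_factored[of r p] by (simp add: p_def r_def algebra_simps)
  then have "r - p = 1 / (r + p)"
    using pr by (simp add: eq_divide_eq)
  moreover have "1 / p - 1 / r = (r - p) / (p * r)"
    using pr by (simp add: field_simps)
  ultimately have "1 / p - 1 / r = 1 / (p * r * (r + p))"
    by (simp add: mult.commute)
  moreover have "1 / (r * r * (r + r)) \<le> 1 / (p * r * (r + p))"
    using pr by (intro divide_left_mono mult_mono) auto
  moreover have "real (Suc L) powr (- 3 / 2) = 1 / (r * r * r)"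
  proof -
    have "real (Suc L) powr (- 3 / 2) = 1 / (real (Suc L) powr (1 / 2)) ^ 3"
      by (simp add: powr_power powr_minus_divide)
    then show ?thesis
      by (simp add: powr_half_sqrt r_def power3_eq_cube)
  qed
  moreover have "1 / (r * r * r) = 2 * (1 / (r * r * (r + r)))" "2 / p - 2 / r = 2 * (1 / p - 1 / r)"
    using pr by simp_all
  ultimately have "real (Suc L) powr (- 3 / 2) \<le> 2 / p - 2 / r"
    by linarith
  then show ?case
    using step by (simp add: p_def r_def)
qed

text \<open>Split at \<open>sqrt N\<close>. The power saving gives 59 * 18 = 1062 below, the
  convergent tail 5 * 4 = 20 above. The bound is uniform in \<open>L\<close>, which permits a limit
  later.\<close>

lemma abs_sum_divisor_error_le:
  fixes N L :: nat
  assumes "N \<ge> 1" "N \<le> L"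
  shows "\<bar>\<Sum>d=1..L. divisor_error (real N / real d ^ 2)\<bar> \<le> 1082 * sqrt (real N)"
proof -
  define s where "s = sqrt (real N)"
  define m where "m = nat \<lfloor>s\<rfloor>"
  have s: "s \<ge> 1" "real N = s ^ 2"
    using assms by (simp_all add: s_def)
  have "1 \<le> \<lfloor>s\<rfloor>"
    using s(1) by simp
  then have m: "real m \<le> s" "s < real m + 1" "1 \<le> m"
    unfolding m_def by linarith+
  have "s * 1 \<le> s * s"
    using s by (intro mult_left_mono) auto
  then have "s \<le> real N"
    using s by (simp add: power2_eq_square)
  then have "real m \<le> real L"
    using m assms by linarith
  then have mL: "m \<le> L"
    by simp
  have powr_ratio: "(real N / real d ^ 2) powr e = s powr (2 * e) * real d powr (- (2 * e))"
    if "d > 0" for d e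
  proof -
    have "real N / real d ^ 2 = (s / real d) powr 2"
      using s that by (simp add: power_divide)
    then have "(real N / real d ^ 2) powr e = (s / real d) powr (2 * e)"
      by (simp only: powr_powr)
    then show ?thesis
      using s that by (simp add: powr_divide powr_minus_divide)
  qed
  have small: "\<bar>divisor_error (real N / real d ^ 2)\<bar> \<le> 59 * s powr (17 / 18) * real d powr (- 17 / 18)"
    if "d \<in> {1..m}" for d
  proof -
    have "real d \<le> s"
      using that m by auto
    then have "real d ^ 2 \<le> s ^ 2"
      by (intro power_mono) auto
    then have "1 \<le> real N / real d ^ 2"
      using that s by simp
    from divisor_error_ge_1[OF this] show ?thesis
      using that by (simp add: powr_ratio)
  qed
  have large: "\<bar>divisor_error (real N / real d ^ 2)\<bar> \<le> 5 * s powr (3 / 2) * real d powr (- 3 / 2)"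
    if "d \<in> {m+1..L}" for d
  proof -
    have "s < real d"
      using that m by auto
    then have "s ^ 2 < real d ^ 2"
      using s by (intro power_strict_mono) auto
    then have "0 < real N / real d ^ 2" "real N / real d ^ 2 < 1"
      using that s by simp_all
    from divisor_error_less_1[OF this] show ?thesis
      using that by (simp add: powr_ratio)
  qed
  have "\<bar>\<Sum>d=1..m. divisor_error (real N / real d ^ 2)\<bar>
      \<le> (\<Sum>d=1..m. 59 * s powr (17 / 18) * real d powr (- 17 / 18))"
    by (rule order.trans[OF sum_abs]) (intro sum_mono small)
  also have "\<dots> = 59 * s powr (17 / 18) * (\<Sum>d=1..m. real d powr (- 17 / 18))"
    by (simp only: sum_distrib_left)
  also have "\<dots> \<le> 59 * s powr (17 / 18) * (18 * s powr (1 / 18))"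
  proof (intro mult_left_mono)
    have "real m powr (1 / 18) \<le> s powr (1 / 18)"
      using m by (intro powr_mono2) auto
    then show "(\<Sum>d=1..m. real d powr (- 17 / 18)) \<le> 18 * s powr (1 / 18)"
      using sum_powr_neg_17_18_le[of m] by linarith
  qed auto
  also have "\<dots> = 1062 * s"
    using s by (simp flip: powr_add)
  finally have 1: "\<bar>\<Sum>d=1..m. divisor_error (real N / real d ^ 2)\<bar> \<le> 1062 * s" .
  have "\<bar>\<Sum>d=m+1..L. divisor_error (real N / real d ^ 2)\<bar>
      \<le> (\<Sum>d=m+1..L. 5 * s powr (3 / 2) * real d powr (- 3 / 2))"
    by (rule order.trans[OF sum_abs]) (intro sum_mono large)
  also have "\<dots> = 5 * s powr (3 / 2) * (\<Sum>d=m+1..L. real d powr (- 3 / 2))"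
    by (simp only: sum_distrib_left)
  also have "\<dots> \<le> 5 * s powr (3 / 2) * (4 / sqrt s)"
  proof (intro mult_left_mono)
    have "sqrt s \<le> sqrt (4 * real m)"
      using m by (intro real_sqrt_le_mono) linarith
    also have "\<dots> = 2 * sqrt (real m)"
      by (simp add: real_sqrt_mult)
    finally have "2 / sqrt (real m) \<le> 4 / sqrt s"
      using m s by (simp add: field_simps)
    moreover have "0 \<le> 2 / sqrt (real L)"
      by simp
    ultimately show "(\<Sum>d=m+1..L. real d powr (- 3 / 2)) \<le> 4 / sqrt s"
      using sum_powr_neg_3_2_le[OF m(3) mL] by linarith
  qed auto
  also have "\<dots> = 20 * s"
  proof -
    have "s powr (3 / 2) = s * sqrt s"
      using s powr_add[of s 1 "1/2"] by (simp add: powr_half_sqrt)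
    then show ?thesis
      using s by simp
  qed
  finally have 2: "\<bar>\<Sum>d=m+1..L. divisor_error (real N / real d ^ 2)\<bar> \<le> 20 * s" .
  have "(\<Sum>d=1..L. divisor_error (real N / real d ^ 2))
      = (\<Sum>d=1..m. divisor_error (real N / real d ^ 2)) + (\<Sum>d=m+1..L. divisor_error (real N / real d ^ 2))"
    using sum.ub_add_nat[of 1 m _ "L - m"] mL by simp
  then show ?thesis
    using 1 2 unfolding s_def[symmetric] by linarith
qed

section \<open>Sorting by common divisors\<close>

text \<open>\<open>tau (gcd a b)\<close> counts the common divisors \<open>d\<close>; after
  exchanging the sums, dividing both coordinates by \<open>d\<close> leaves pairs with product at
  most \<open>N / d ^ 2\<close>. Common divisors never exceed \<open>N\<close>, so the cutoff
  \<open>L\<close> is free above \<open>N\<close>.\<close>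

lemma S_eq_sum_hyperbola_pairs:
  assumes "N \<le> L"
  shows "S N = (\<Sum>d=1..L. card (hyperbola_pairs (real N / real d ^ 2)))"
proof -
  define P where "P = {(a, b). 1 \<le> a \<and> 1 \<le> b \<and> a * b \<le> N}"
  have "P = hyperbola_pairs (real N)"
    unfolding P_def hyperbola_pairs_def by (simp only: of_nat_le_iff)
  then have "finite P"
    by (simp add: finite_hyperbola_pairs)
  have tau: "tau (gcd a b) = (\<Sum>d=1..L. if d dvd a \<and> d dvd b then 1 else 0)"
    if "(a, b) \<in> P" for a b
  proof -
    have ab: "1 \<le> a" "1 \<le> b" "a * b \<le> N"
      using that by (auto simp: P_def)
    then have "a \<le> a * b"
      by simp
    then have "a \<le> L"
      using ab assms by linarith
    moreover have "1 \<le> d \<and> d \<le> a" if "d dvd a" for d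
      using that ab(1) by (auto dest: dvd_imp_le intro: Suc_leI dvd_pos_nat)
    ultimately have "{d. d dvd gcd a b} = {d \<in> {1..L}. d dvd a \<and> d dvd b}"
      by fastforce
    then show ?thesis
      by (simp add: tau_def sum.If_cases Int_def conj_ac)
  qed
  have card: "(\<Sum>(a, b)\<in>P. if d dvd a \<and> d dvd b then 1 else 0)
      = card (hyperbola_pairs (real N / real d ^ 2))" if "d \<in> {1..L}" for d
  proof -
    have "(\<Sum>(a, b)\<in>P. if d dvd a \<and> d dvd b then 1 else 0)
        = card {(a, b) \<in> P. d dvd a \<and> d dvd b}"
      using \<open>finite P\<close> by (simp add: case_prod_unfold sum.If_cases Int_def)
    also have "{(a, b) \<in> P. d dvd a \<and> d dvd b}
        = (\<lambda>(a, b). (d * a, d * b)) ` hyperbola_pairs (real N / real d ^ 2)"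
    proof -
      have iff: "(d * a, d * b) \<in> P \<longleftrightarrow> (a, b) \<in> hyperbola_pairs (real N / real d ^ 2)" for a b
      proof -
        have "real (a * b) \<le> real N / real d ^ 2 \<longleftrightarrow> real (d * a * (d * b)) \<le> real N"
          using that by (simp add: field_simps power2_eq_square)
        also have "\<dots> \<longleftrightarrow> d * a * (d * b) \<le> N"
          by (simp only: of_nat_le_iff)
        finally have "d * a * (d * b) \<le> N \<longleftrightarrow> real (a * b) \<le> real N / real d ^ 2" ..
        moreover have "1 \<le> d * c \<longleftrightarrow> 1 \<le> c" for c
          using that by simp
        ultimately show ?thesis
          unfolding P_def hyperbola_pairs_def mem_Collect_eq prod.case by (simp only:)
      qed
      have "p \<in> (\<lambda>(a, b). (d * a, d * b)) ` hyperbola_pairs (real N / real d ^ 2)"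
        if p: "p \<in> {(a, b) \<in> P. d dvd a \<and> d dvd b}" for p
      proof -
        obtain a b where ab: "p = (d * a, d * b)" "(d * a, d * b) \<in> P"
          using p by (auto elim!: dvdE)
        then have "(a, b) \<in> hyperbola_pairs (real N / real d ^ 2)"
          by (simp only: iff)
        then show ?thesis
          using ab(1) by (intro rev_image_eqI[of "(a, b)"]) simp_all
      qed
      moreover have "(d * a, d * b) \<in> P" if "(a, b) \<in> hyperbola_pairs (real N / real d ^ 2)" for a b
        using that by (simp only: iff)
      ultimately show ?thesis
        by fastforce
    qed
    also have "card \<dots> = card (hyperbola_pairs (real N / real d ^ 2))"
      using that by (intro card_image) (auto simp: inj_on_def)
    finally show ?thesis .
  qed
  have "S N = (\<Sum>(a, b)\<in>P. \<Sum>d=1..L. if d dvd a \<and> d dvd b then 1 else 0)"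
    unfolding S_def P_def[symmetric] by (intro sum.cong) (auto simp: tau)
  also have "\<dots> = (\<Sum>d=1..L. \<Sum>(a, b)\<in>P. if d dvd a \<and> d dvd b then 1 else 0)"
    unfolding case_prod_unfold by (rule sum.swap)
  also have "\<dots> = (\<Sum>d=1..L. card (hyperbola_pairs (real N / real d ^ 2)))"
    by (intro sum.cong card refl)
  finally show ?thesis .
qed

section \<open>The constants and the passage to the limit\<close>

lemma zeta2_sums: "(\<lambda>d. 1 / real (Suc d) ^ 2) sums zeta2"
proof -
  have "summable (\<lambda>d. 1 / real (Suc d) ^ 2)"
    using inverse_power_summable[of 2, where ?'a = real]
    by (subst summable_Suc_iff[of "\<lambda>d. 1 / real d ^ 2"]) (simp add: inverse_eq_divide)
  then show ?thesis
    unfolding zeta2_def by (rule summable_sums)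
qed

text \<open>Comparison through \<open>ln u \<le> 2 * sqrt u\<close>.\<close>

lemma theta_sums: "(\<lambda>d. ln (real (Suc d)) / real (Suc d) ^ 2) sums theta"
proof -
  have "summable (\<lambda>d. 2 * real (Suc d) powr (- 3 / 2))"
    by (intro summable_mult, subst summable_Suc_iff[of "\<lambda>d. real d powr (- 3 / 2)"])
       (simp add: summable_real_powr_iff)
  moreover have "norm (ln (real (Suc d)) / real (Suc d) ^ 2) \<le> 2 * real (Suc d) powr (- 3 / 2)" for d
  proof -
    define u where "u = real (Suc d)"
    have u: "u \<ge> 1"
      by (simp add: u_def)
    have "ln u \<le> u powr (1 / 2) / (1 / 2)"
      using u by (intro ln_powr_bound) auto
    then have "ln u / u ^ 2 \<le> 2 * u powr (1 / 2) / u ^ 2"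
      using u by (intro divide_right_mono) auto
    also have "\<dots> = 2 * (u powr (1 / 2) / u powr 2)"
      using u by simp
    also have "\<dots> = 2 * u powr (- 3 / 2)"
      by (subst powr_diff[symmetric]) simp
    finally show ?thesis
      using u unfolding u_def[symmetric] by simp
  qed
  ultimately have "summable (\<lambda>d. ln (real (Suc d)) / real (Suc d) ^ 2)"
    by (rule summable_comparison_test')
  then show ?thesis
    unfolding theta_def by (rule summable_sums)
qed

theorem theorem1:
  "\<exists>C > 0. \<forall>N :: nat. N \<ge> 1 \<longrightarrow>
     \<bar>real (S N) - zeta2 * real N * ln (real N)
       - ((2 * euler_mascheroni - 1) * zeta2 - 2 * theta) * real N\<bar>
     \<le> C * sqrt (real N)"
proof (intro exI[of _ 1082] conjI allI impI)
  fix N :: nat assume N: "N \<ge> 1"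
  define g :: real where "g = 2 * euler_mascheroni - 1"
  define Z where "Z L = (\<Sum>d<L. 1 / real (Suc d) ^ 2)" for L
  define T where "T L = (\<Sum>d<L. ln (real (Suc d)) / real (Suc d) ^ 2)" for L
  \<comment> \<open>The quantity to be bounded, with the series for \<open>zeta2\<close> and
    \<open>theta\<close> cut off at \<open>L\<close>. For \<open>L \<ge> N\<close> it equals a sum
    of divisor errors exactly, so no tail estimate for the two series is required: the bound
    survives letting \<open>L\<close> tend to infinity.\<close>
  define F where "F L = real (S N) - Z L * real N * ln (real N) - (g * Z L - 2 * T L) * real N" for L
  have "F L = (\<Sum>d=1..L. divisor_error (real N / real d ^ 2))" if "N \<le> L" for L
  proof -
    have error_eq: "divisor_error (real N / real d ^ 2)
        = real (card (hyperbola_pairs (real N / real d ^ 2)))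
          - ((1 / real d ^ 2) * (real N * ln (real N) + g * real N)
             - (ln (real d) / real d ^ 2) * (2 * real N))" if "d \<in> {1..L}" for d
    proof -
      \<comment> \<open>The summand \<open>- 2 * ln d\<close> is the origin of
        \<open>- 2 * theta\<close>.\<close>
      have ln_eq: "ln (real N / real d ^ 2) = ln (real N) - 2 * ln (real d)"
        using N that by (simp add: ln_div ln_realpow)
      show ?thesis
        unfolding divisor_error_def g_def[symmetric] ln_eq
        by (simp add: algebra_simps add_divide_distrib diff_divide_distrib)
    qed
    have "(\<Sum>d=1..L. divisor_error (real N / real d ^ 2))
        = real (S N) - ((\<Sum>d=1..L. 1 / real d ^ 2) * (real N * ln (real N) + g * real N)
          - (\<Sum>d=1..L. ln (real d) / real d ^ 2) * (2 * real N))"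
      unfolding S_eq_sum_hyperbola_pairs[OF that] of_nat_sum sum_distrib_right sum_subtractf[symmetric]
      by (intro sum.cong error_eq refl)
    also have "(\<Sum>d=1..L. 1 / real d ^ 2) = Z L"
      unfolding Z_def by (rule sum.reindex_bij_witness[of _ Suc "\<lambda>d. d - 1"]) auto
    also have "(\<Sum>d=1..L. ln (real d) / real d ^ 2) = T L"
      unfolding T_def by (rule sum.reindex_bij_witness[of _ Suc "\<lambda>d. d - 1"]) auto
    finally show ?thesis
      by (simp add: F_def algebra_simps)
  qed
  then have "\<forall>L\<ge>N. \<bar>F L\<bar> \<le> 1082 * sqrt (real N)"
    using abs_sum_divisor_error_le[OF N] by simp
  moreover have "(\<lambda>L. \<bar>F L\<bar>) \<longlonglongrightarrow>
      \<bar>real (S N) - zeta2 * real N * ln (real N) - (g * zeta2 - 2 * theta) * real N\<bar>"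
    using zeta2_sums theta_sums unfolding sums_def Z_def[symmetric] T_def[symmetric] F_def
    by (intro tendsto_intros)
  ultimately show "\<bar>real (S N) - zeta2 * real N * ln (real N)
       - ((2 * euler_mascheroni - 1) * zeta2 - 2 * theta) * real N\<bar> \<le> 1082 * sqrt (real N)"
    unfolding g_def[symmetric] using LIMSEQ_le_const2 by blast
qed simp

end
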